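(* Let $(X,T)$ be a topological dynamical system, let $\mathbf{F}=\{\mathbf{f}_n\}_{n=1}^\infty$ be a block sub-additive potential on $X$, and let $\mathcal{U}\in\mathcal{C}_X^o$ be an open cover of $X$. Let $\mathcal{F}=\{f_n\}_{n=1}^\infty$, $f_n(x)=\mathbf{f}_n(x,Tx,\ldots,T^{n-1}x)$, be the sub-additive potential induced by $\mathbf{F}$, and assume $\mathcal{F}_*(\mu)>-\infty$ for all $\mu\in M(X,T)$. Then $$GP(T,\mathbf{F},\mathcal{U})=P(T,\mathcal{F},\mathcal{U}).$$
   Context: A topological dynamical system (TDS) $(X,T)$ is a compact metric space $X$ with metric $d$ together with a continuous surjective map $T:X\to X$. $C(Z)$ is the space of real-valued continuous functions on $Z$; $M(X,T)$ is the set of $T$-invariant Borel probability measures on $X$. A block sub-additive potential on $X$ is a sequence $\mathbf{F}=\{\mathbf{f}_n\}_{n=1}^\infty$ with $\mathbf{f}_n\in C(X^n)$ such that $\mathbf{f}_{n+m}(x_0,\ldots,x_{n+m-1})\le \mathbf{f}_n(x_0,\ldots,x_{n-1})+\mathbf{f}_m(x_n,\ldots,x_{n+m-1})$ for all $m,n\ge 1$ and all points. The induced sequence $f_n(x)=\mathbf{f}_n(x,Tx,\ldots,T^{n-1}x)$ satisfies $f_{m+n}(x)\le f_m(x)+f_n(T^mx)$, i.e. it is a sub-additive potential, and $\mathcal{F}_*(\mu)=\lim_{n\to\infty}\frac1n\int f_n\,d\mu$ (the limit exists by sub-additivity). Covers: for a subset $K$ of a compact metric space $Z$, a cover of $K$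 is a finite family of Borel subsets of $K$ whose union is $K$; $\mathcal{C}_K$ is the set of all covers of $K$, and $\mathcal{C}_K^o$ the set of those consisting of relatively open sets. For $\mathcal{V}\in\mathcal{C}_K$ and $\mathcal{W}\in\mathcal{C}_Z$, $\mathcal{V}\succeq\mathcal{W}$ means every element of $\mathcal{V}$ is contained in some element of $\mathcal{W}$. For $\mathcal{U}\in\mathcal{C}_X$: $\mathcal{U}^n=\{U_1\times\cdots\times U_n: U_i\in\mathcal{U}\}\in\mathcal{C}_{X^n}$, and $\mathcal{U}_0^{n-1}=\bigvee_{j=0}^{n-1}T^{-j}\mathcal{U}$, where $\mathcal{U}\vee\mathcal{V}=\{U\cap V:U\in\mathcal{U},V\in\mathcal{V}\}$. In the sums below, empty sets contribute $0$. Pressure of the sub-additive potential: $P_n(T,\mathcal{F},\mathcal{U})=\inf\{\sum_{V\in\mathcal{V}}\sup_{x\in V}e^{f_n(x)}:\mathcal{V}\in\mathcal{C}_X,\ \mathcal{V}\succeq\mathcal{U}_0^{n-1}\}$ and $P(T,\mathcal{F},\mathcal{U})=\lim_{n\to\infty}\frac1n\log P_n(T,\mathcal{F},\mathcal{U})$ (the limit exists). Average pseudo-orbits: for $\delta>0$ (and $n\ge2$), $X^n_\delta$ is the set of $(x_0,\ldots,x_{n-1})\in X^n$ with $\frac{1}{n-1}\sum_{i=0}^{n-2}d(Tx_i,x_{i+1})\le\delta$. Pressure of the block potential: $GP_{n,\delta}(T,\mathbf{F},\mathcal{U})=\inf\{\sum_{V\in\mathcal{V}}\sup_{\mathbf{x}\in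 V}e^{\mathbf{f}_n(\mathbf{x})}:\mathcal{V}\in\mathcal{C}_{X^n_\delta},\ \mathcal{V}\succeq\mathcal{U}^n\}$, $GP_\delta(T,\mathbf{F},\mathcal{U})=\limsup_{n\to\infty}\frac1n\log GP_{n,\delta}(T,\mathbf{F},\mathcal{U})$, and $GP(T,\mathbf{F},\mathcal{U})=\inf_{\delta>0}GP_\delta(T,\mathbf{F},\mathcal{U})$. *)

theory Defs
  imports "HOL-Probability.Probability"
begin

section \<open>Systems and potentials\<close>

text \<open>The space \<open>X\<close> is the type \<open>'a\<close>; its metric is that of the class \<^class>\<open>metric_space\<close>.\<close>

definition tds :: "('a::metric_space \<Rightarrow> 'a) \<Rightarrow> bool" where
  "tds T \<longleftrightarrow> compact (UNIV :: 'a set) \<and> continuous_on UNIV T \<and> surj T"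

definition invariant_measures :: "('a::metric_space \<Rightarrow> 'a) \<Rightarrow> 'a measure set" where
  "invariant_measures T = {\<mu>. prob_space \<mu> \<and> sets \<mu> = sets borel \<and> distr \<mu> borel T = \<mu>}"

text \<open>Points \<open>(x\<^sub>0, \<dots>, x\<^sub>n\<^sub>-\<^sub>1)\<close> of \<open>X\<^sup>n\<close> are functions on \<open>{..<n}\<close> extended by \<^const>\<open>undefined\<close>;
  this is the carrier of the product topology.\<close>

abbreviation power_top :: "nat \<Rightarrow> (nat \<Rightarrow> 'a::metric_space) topology" where
  "power_top n \<equiv> product_topology (\<lambda>_. euclidean) {..<n}"

text \<open>The sequence is indexed from 1; the value at index 0 is irrelevant.\<close>

definition block_subadditive :: "(nat \<Rightarrow> (nat \<Rightarrow> 'a::metric_space) \<Rightarrow> real) \<Rightarrow> bool" where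
  "block_subadditive F \<longleftrightarrow>
     (\<forall>n\<ge>1. continuous_map (power_top n) euclideanreal (F n)) \<and>
     (\<forall>m\<ge>1. \<forall>n\<ge>1. \<forall>x \<in> topspace (power_top (n + m)).
        F (n + m) x \<le> F n (restrict x {..<n}) + F m (\<lambda>i\<in>{..<m}. x (n + i)))"

definition induced_potential ::
  "('a \<Rightarrow> 'a) \<Rightarrow> (nat \<Rightarrow> (nat \<Rightarrow> 'a) \<Rightarrow> real) \<Rightarrow> nat \<Rightarrow> 'a \<Rightarrow> real" where
  "induced_potential T F n x = F n (\<lambda>i\<in>{..<n}. (T ^^ i) x)"

text \<open>For sub-additive potentials and invariant measures the limit exists in \<open>[-\<infinity>, \<infinity>)\<close>.\<close>

definition potential_mean :: "(nat \<Rightarrow> 'a \<Rightarrow> real) \<Rightarrow> 'a measure \<Rightarrow> ereal" where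
  "potential_mean f \<mu> = lim (\<lambda>n. ereal ((\<integral>x. f n x \<partial>\<mu>) / real n))"

section \<open>Covers\<close>

definition borel_sets_of :: "'b topology \<Rightarrow> 'b set set" where
  "borel_sets_of Z = sigma_sets (topspace Z) {U. openin Z U}"

lemma borel_sets_of_euclidean: "borel_sets_of euclidean = sets (borel :: 'a::topological_space measure)"
  by (simp add: borel_sets_of_def borel_def)

definition covers :: "'b topology \<Rightarrow> 'b set \<Rightarrow> 'b set set set" where
  "covers Z K = {\<V>. finite \<V> \<and> \<V> \<subseteq> borel_sets_of (subtopology Z K) \<and> \<Union>\<V> = K}"

definition open_covers :: "'b topology \<Rightarrow> 'b set \<Rightarrow> 'b set set set" where
  "open_covers Z K = {\<V> \<in> covers Z K. \<forall>V\<in>\<V>. openin (subtopology Z K) V}"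

definition finer :: "'b set set \<Rightarrow> 'b set set \<Rightarrow> bool" where
  "finer \<V> \<W> \<longleftrightarrow> (\<forall>V\<in>\<V>. \<exists>W\<in>\<W>. V \<subseteq> W)"

definition join_cover :: "'b set set \<Rightarrow> 'b set set \<Rightarrow> 'b set set" where
  "join_cover \<U> \<V> = {U \<inter> V |U V. U \<in> \<U> \<and> V \<in> \<V>}"

text \<open>\<open>dyn_join T \<U> n\<close> is the join of \<open>T\<^sup>-\<^sup>j\<U>\<close> over \<open>j < n\<close>, usually written \<open>\<U>\<^sub>0\<close> with
  upper index \<open>n - 1\<close>.\<close>

primrec dyn_join :: "('a \<Rightarrow> 'a) \<Rightarrow> 'a set set \<Rightarrow> nat \<Rightarrow> 'a set set" where
  "dyn_join T \<U> 0 = {UNIV}"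
| "dyn_join T \<U> (Suc n) = join_cover (dyn_join T \<U> n) ((\<lambda>U. (T ^^ n) -` U) ` \<U>)"

definition power_cover :: "'a set set \<Rightarrow> nat \<Rightarrow> (nat \<Rightarrow> 'a) set set" where
  "power_cover \<U> n = {Pi\<^sub>E {..<n} U |U. \<forall>i<n. U i \<in> \<U>}"

text \<open>The infimum, over all covers of \<open>K\<close> finer than \<open>\<W>\<close>, of the sums of suprema of \<open>exp \<circ> g\<close>.
  For \<open>g\<close> continuous on a compact \<open>Z\<close> all suprema and infima below are those of bounded sets.\<close>

definition cover_sum :: "('b \<Rightarrow> real) \<Rightarrow> 'b set set \<Rightarrow> real" where
  "cover_sum g \<V> = (\<Sum>V\<in>\<V>. if V = {} then 0 else (SUP x\<in>V. exp (g x)))"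

definition inf_cover_sum ::
  "'b topology \<Rightarrow> 'b set \<Rightarrow> ('b \<Rightarrow> real) \<Rightarrow> 'b set set \<Rightarrow> real" where
  "inf_cover_sum Z K g \<W> = (INF \<V> \<in> {\<V> \<in> covers Z K. finer \<V> \<W>}. cover_sum g \<V>)"

section \<open>Pressures\<close>

definition P_n :: "('a::metric_space \<Rightarrow> 'a) \<Rightarrow> (nat \<Rightarrow> 'a \<Rightarrow> real) \<Rightarrow> 'a set set \<Rightarrow> nat \<Rightarrow> real" where
  "P_n T f \<U> n = inf_cover_sum euclidean UNIV (f n) (dyn_join T \<U> n)"

text \<open>The limit exists in \<open>[-\<infinity>, \<infinity>)\<close> for sub-additive potentials.\<close>

definition pressure :: "('a::metric_space \<Rightarrow> 'a) \<Rightarrow> (nat \<Rightarrow> 'a \<Rightarrow> real) \<Rightarrow> 'a set set \<Rightarrow> ereal" where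
  "pressure T f \<U> = lim (\<lambda>n. ereal (ln (P_n T f \<U> n) / real n))"

text \<open>Meaningful for \<open>n \<ge> 2\<close> only; smaller \<open>n\<close> do not affect the upper limit below.\<close>

definition pseudo_orbits :: "('a::metric_space \<Rightarrow> 'a) \<Rightarrow> real \<Rightarrow> nat \<Rightarrow> (nat \<Rightarrow> 'a) set" where
  "pseudo_orbits T \<delta> n =
     {x \<in> topspace (power_top n). (\<Sum>i<n - 1. dist (T (x i)) (x (Suc i))) / real (n - 1) \<le> \<delta>}"

definition GP_n_delta ::
  "('a::metric_space \<Rightarrow> 'a) \<Rightarrow> (nat \<Rightarrow> (nat \<Rightarrow> 'a) \<Rightarrow> real) \<Rightarrow> 'a set set \<Rightarrow> real \<Rightarrow> nat \<Rightarrow> real" where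
  "GP_n_delta T F \<U> \<delta> n =
     inf_cover_sum (power_top n) (pseudo_orbits T \<delta> n) (F n) (power_cover \<U> n)"

definition GP_delta ::
  "('a::metric_space \<Rightarrow> 'a) \<Rightarrow> (nat \<Rightarrow> (nat \<Rightarrow> 'a) \<Rightarrow> real) \<Rightarrow> 'a set set \<Rightarrow> real \<Rightarrow> ereal" where
  "GP_delta T F \<U> \<delta> = limsup (\<lambda>n. ereal (ln (GP_n_delta T F \<U> \<delta> n) / real n))"

definition GP ::
  "('a::metric_space \<Rightarrow> 'a) \<Rightarrow> (nat \<Rightarrow> (nat \<Rightarrow> 'a) \<Rightarrow> real) \<Rightarrow> 'a set set \<Rightarrow> ereal" where
  "GP T F \<U> = (INF \<delta>\<in>{0<..}. GP_delta T F \<U> \<delta>)"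

end

theory Submission
  imports Defs
begin

text \<open>For \<open>\<tau> \<ge> 0\<close> subtract from \<open>F\<^sub>n\<close> the penalty \<open>\<tau>\<close> times the defect
  \<open>\<Sum>i<n - 1. dist (T x\<^sub>i) x\<^sub>i\<^sub>+\<^sub>1\<close>. The defect is super-additive, so the penalized potential is again
  block sub-additive, and it induces the same potential because the defect vanishes on orbits.
  Hence its cover sums \<open>Q\<^sub>n\<close> over the whole of \<open>X\<^sup>n\<close> are submultiplicative. On \<open>\<delta>\<close>-pseudo-orbits
  the penalty costs at most a factor \<open>exp (n \<tau> \<delta>)\<close>, so that \<open>GP\<close> is at most
  \<open>\<tau> \<delta> + ln Q\<^sub>m / m\<close> for every \<open>m\<close>; let \<open>\<delta>\<close> tend to 0. For fixed \<open>m\<close>, a near-optimal cover of \<open>X\<close>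
  for \<open>P\<^sub>m\<close> extends to open sets around the orbit segments in \<open>X\<^sup>m\<close>, and on the compact complement
  of those the defect is bounded below, so its contribution vanishes as \<open>\<tau>\<close> grows. This yields
  \<open>GP \<le> ln P\<^sub>m / m\<close> for every \<open>m\<close>. Together with \<open>P\<^sub>n \<le> GP\<^sub>n\<^sub>,\<^sub>\<delta>\<close>, obtained by restricting covers to
  orbits, it also gives the existence of the limit defining the pressure.\<close>

section \<open>Cover sums\<close>

lemma borel_sets_of_eq_sets:
  "borel_sets_of Z = sets (sigma (topspace Z) {U. openin Z U})"
  unfolding borel_sets_of_def
  by (rule sets_measure_of[symmetric]) (auto dest: openin_subset)

lemma borel_sets_of_openin: "openin Z U \<Longrightarrow> U \<in> borel_sets_of Z"
  unfolding borel_sets_of_def by auto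

lemma borel_sets_of_Int:
  "A \<in> borel_sets_of Z \<Longrightarrow> B \<in> borel_sets_of Z \<Longrightarrow> A \<inter> B \<in> borel_sets_of Z"
  unfolding borel_sets_of_eq_sets by auto

lemma borel_sets_of_Diff:
  "A \<in> borel_sets_of Z \<Longrightarrow> B \<in> borel_sets_of Z \<Longrightarrow> A - B \<in> borel_sets_of Z"
  unfolding borel_sets_of_eq_sets by auto

text \<open>Measurability of a continuous map need only be checked on the generating open sets. This
  is what turns covers into covers when they are pulled back.\<close>

lemma borel_sets_of_vimage:
  assumes "continuous_map Z' Z \<phi>" "V \<in> borel_sets_of Z"
  shows "\<phi> -` V \<inter> topspace Z' \<in> borel_sets_of Z'"
proof -
  have *: "{U. openin Y U} \<subseteq> Pow (topspace Y)" for Y :: "'x topology"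
    by (auto dest: openin_subset)
  have "\<phi> \<in> sigma (topspace Z') {U. openin Z' U} \<rightarrow>\<^sub>M sigma (topspace Z) {U. openin Z U}"
  proof (rule measurable_measure_of)
    show "{U. openin Z U} \<subseteq> Pow (topspace Z)" by (rule *)
    show "\<phi> \<in> space (sigma (topspace Z') {U. openin Z' U}) \<rightarrow> topspace Z"
      using assms(1) by (auto simp: space_measure_of_conv continuous_map_def)
    fix U assume "U \<in> {U. openin Z U}"
    then have "openin Z' {x \<in> topspace Z'. \<phi> x \<in> U}"
      using assms(1) by (auto simp: continuous_map_def)
    moreover have "{x \<in> topspace Z'. \<phi> x \<in> U} = \<phi> -` U \<inter> topspace Z'" by auto
    ultimately show "\<phi> -` U \<inter> space (sigma (topspace Z') {U. openin Z' U})
        \<in> sets (sigma (topspace Z') {U. openin Z' U})"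
      using borel_sets_of_openin[of Z'] by (simp add: borel_sets_of_eq_sets space_measure_of_conv)
  qed
  from measurable_sets[OF this assms(2)[unfolded borel_sets_of_eq_sets]] show ?thesis
    unfolding borel_sets_of_eq_sets by (simp add: space_measure_of_conv)
qed

section \<open>Cover sums by means of weighted families\<close>

lemma coversD:
  assumes "\<V> \<in> covers Z K"
  shows "finite \<V>" "\<And>V. V \<in> \<V> \<Longrightarrow> V \<in> borel_sets_of (subtopology Z K)" "\<Union>\<V> = K"
    "\<And>V. V \<in> \<V> \<Longrightarrow> V \<subseteq> K"
  using assms unfolding covers_def by auto

text \<open>The tool for all upper bounds: a cover may be given as an indexed family with any
  weights dominating \<open>exp \<circ> g\<close>. Indices with equal sets are harmless, since
  repetitions only increase the right-hand side.\<close>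

lemma inf_cover_sum_le:
  fixes S :: "'i \<Rightarrow> 'b set"
  assumes fin: "finite I"
    and S: "\<And>i. i \<in> I \<Longrightarrow> S i \<in> borel_sets_of (subtopology Z K)"
    and un: "(\<Union>i\<in>I. S i) = K"
    and fine: "\<And>i. i \<in> I \<Longrightarrow> \<exists>W\<in>\<W>. S i \<subseteq> W"
    and h0: "\<And>i. i \<in> I \<Longrightarrow> 0 \<le> h i"
    and h: "\<And>i x. i \<in> I \<Longrightarrow> x \<in> S i \<Longrightarrow> exp (g x) \<le> h i"
  shows "inf_cover_sum Z K g \<W> \<le> (\<Sum>i\<in>I. h i)"
proof -
  \<comment> \<open>The total weight bounds \<open>exp \<circ> g\<close> on \<open>K\<close>, so the
    suprema in \<open>s\<close> are those of sets bounded above and hence nonnegative.\<close>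
  have K: "exp (g x) \<le> (\<Sum>i\<in>I. h i)" if x: "x \<in> K" for x
  proof -
    obtain i where i: "i \<in> I" "x \<in> S i" using x un by auto
    have "exp (g x) \<le> h i" using h i by auto
    also have "\<dots> \<le> (\<Sum>i\<in>I. h i)" using i fin h0 by (intro member_le_sum) auto
    finally show ?thesis .
  qed
  define s where "s V = (if V = {} then 0 else (SUP x\<in>V. exp (g x)))" for V
  have s0: "0 \<le> s V" if "V \<subseteq> K" for V
  proof (cases "V = {}")
    case False
    then obtain x where "x \<in> V" by auto
    then have "0 \<le> (SUP x\<in>V. exp (g x))"
      using K that by (intro cSUP_upper2[of _ V x]) (auto intro!: bdd_aboveI)
    then show ?thesis by (simp add: s_def)
  qed (simp add: s_def)
  have cov: "S ` I \<in> covers Z K"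
    using fin S un by (auto simp: covers_def)
  have "inf_cover_sum Z K g \<W> \<le> cover_sum g (S ` I)"
    unfolding inf_cover_sum_def
  proof (rule cINF_lower)
    show "bdd_below (cover_sum g ` {\<V> \<in> covers Z K. finer \<V> \<W>})"
    proof (rule bdd_belowI)
      fix y assume "y \<in> cover_sum g ` {\<V> \<in> covers Z K. finer \<V> \<W>}"
      then obtain \<V> where "\<V> \<in> covers Z K" "y = (\<Sum>V\<in>\<V>. s V)"
        by (auto simp: cover_sum_def s_def)
      then show "0 \<le> y" using s0[OF coversD(4)] by (auto intro!: sum_nonneg)
    qed
    show "S ` I \<in> {\<V> \<in> covers Z K. finer \<V> \<W>}"
      using cov fine by (auto simp: finer_def)
  qed
  also have "\<dots> = (\<Sum>V\<in>S ` I. s V)" by (simp add: cover_sum_def s_def)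
  also have "\<dots> \<le> (\<Sum>i\<in>I. s (S i))"
    using sum_image_le[OF fin, of s S] s0 un by (auto simp: o_def)
  also have "\<dots> \<le> (\<Sum>i\<in>I. h i)"
    using h0 h by (intro sum_mono) (auto simp: s_def intro!: cSUP_least)
  finally show ?thesis .
qed

lemma cover_weights:
  assumes "\<V> \<in> covers Z K" "bdd_above (g ` K)"
  obtains h where "\<And>V. V \<in> \<V> \<Longrightarrow> 0 \<le> h V"
    "\<And>V x. V \<in> \<V> \<Longrightarrow> x \<in> V \<Longrightarrow> exp (g x) \<le> h V" "cover_sum g \<V> = (\<Sum>V\<in>\<V>. h V)"
proof -
  define h where "h V = (if V = {} then 0 else (SUP x\<in>V. exp (g x)))" for V
  obtain M where M: "\<And>x. x \<in> K \<Longrightarrow> g x \<le> M" using assms(2) by (auto simp: bdd_above_def)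
  have h: "exp (g x) \<le> h V" if "V \<in> \<V>" "x \<in> V" for V x
  proof -
    have "bdd_above ((\<lambda>x. exp (g x)) ` V)"
      using coversD(4)[OF assms(1) that(1)] M by (auto intro!: bdd_aboveI[of _ "exp M"])
    then show ?thesis using that by (auto simp: h_def intro!: cSUP_upper)
  qed
  have "0 \<le> h V" if "V \<in> \<V>" for V
  proof (cases "V = {}")
    case False
    then obtain x where "x \<in> V" by auto
    from h[OF that this] show ?thesis using exp_ge_zero[of "g x"] by linarith
  qed (simp add: h_def)
  moreover have "cover_sum g \<V> = (\<Sum>V\<in>\<V>. h V)" by (simp add: cover_sum_def h_def)
  ultimately show thesis using h that by blast
qed

text \<open>Counterpart of \<open>inf_cover_sum_le\<close>: it extracts a near-optimal cover with
  its weights. A refining cover must exist for the infimum to range over a nonempty set, and the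
  bound on \<open>g\<close> makes the suprema dominate the values.\<close>

lemma inf_cover_sum_lessE:
  assumes "inf_cover_sum Z K g \<W> < A" "\<exists>\<V>\<in>covers Z K. finer \<V> \<W>" "bdd_above (g ` K)"
  obtains \<V> h where "\<V> \<in> covers Z K" "finer \<V> \<W>" "\<And>V. V \<in> \<V> \<Longrightarrow> 0 \<le> h V"
    "\<And>V x. V \<in> \<V> \<Longrightarrow> x \<in> V \<Longrightarrow> exp (g x) \<le> h V" "(\<Sum>V\<in>\<V>. h V) < A"
proof -
  have "\<exists>y\<in>cover_sum g ` {\<V> \<in> covers Z K. finer \<V> \<W>}. y < A"
    using assms(1,2) unfolding inf_cover_sum_def by (intro cInf_lessD) auto
  then obtain \<V> where V: "\<V> \<in> covers Z K" "finer \<V> \<W>" "cover_sum g \<V> < A" by auto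
  obtain h where h: "\<And>V. V \<in> \<V> \<Longrightarrow> 0 \<le> h V"
    "\<And>V x. V \<in> \<V> \<Longrightarrow> x \<in> V \<Longrightarrow> exp (g x) \<le> h V" "cover_sum g \<V> = (\<Sum>V\<in>\<V>. h V)"
    by (rule cover_weights[OF V(1) assms(3)]) blast
  show thesis by (rule that[OF V(1,2) h(1,2)]) (use V(3) h(3) in auto)
qed

text \<open>Every cover has a member containing \<open>x\<close>, so every cover sum is at least
  \<open>exp (g x)\<close>. Positivity is what allows logarithms and divisions later.\<close>

lemma inf_cover_sum_pos:
  assumes "x \<in> K" "\<exists>\<V>\<in>covers Z K. finer \<V> \<W>" "bdd_above (g ` K)"
  shows "0 < inf_cover_sum Z K g \<W>"
proof -
  have "exp (g x) \<le> inf_cover_sum Z K g \<W>"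
    unfolding inf_cover_sum_def
  proof (rule cINF_greatest)
    show "{\<V> \<in> covers Z K. finer \<V> \<W>} \<noteq> {}" using assms(2) by auto
    fix \<V> assume "\<V> \<in> {\<V> \<in> covers Z K. finer \<V> \<W>}"
    then have V: "\<V> \<in> covers Z K" by auto
    obtain h where h: "\<And>V. V \<in> \<V> \<Longrightarrow> 0 \<le> h V"
      "\<And>V x. V \<in> \<V> \<Longrightarrow> x \<in> V \<Longrightarrow> exp (g x) \<le> h V" "cover_sum g \<V> = (\<Sum>V\<in>\<V>. h V)"
      by (rule cover_weights[OF V assms(3)]) blast
    obtain W where W: "W \<in> \<V>" "x \<in> W" using assms(1) coversD(3)[OF V] by auto
    have "exp (g x) \<le> h W" using h W by auto
    also have "\<dots> \<le> (\<Sum>V\<in>\<V>. h V)" using W h coversD(1)[OF V] by (intro member_le_sum) auto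
    finally show "exp (g x) \<le> cover_sum g \<V>" using h by simp
  qed
  then show ?thesis using exp_gt_zero[of "g x"] by linarith
qed

section \<open>Pulling covers back along continuous maps\<close>

text \<open>Pull a near-optimal cover of \<open>K\<close> back along \<open>\<phi>\<close> and
  multiply its weights by \<open>exp c\<close>. The lemma serves both for the inclusion of
  pseudo-orbits into the full power and for the map sending a point to its orbit segment.\<close>

lemma inf_cover_sum_comp_le:
  assumes K': "K' \<subseteq> topspace Z'"
    and \<phi>: "continuous_map (subtopology Z' K') (subtopology Z K) \<phi>"
    and fine: "\<And>W. W \<in> \<W> \<Longrightarrow> \<exists>W'\<in>\<W>'. K' \<inter> \<phi> -` W \<subseteq> W'"
    and g: "\<And>x. x \<in> K' \<Longrightarrow> g' x \<le> c + g (\<phi> x)"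
    and ne: "\<exists>\<V>\<in>covers Z K. finer \<V> \<W>"
    and bdd: "bdd_above (g ` K)"
  shows "inf_cover_sum Z' K' g' \<W>' \<le> exp c * inf_cover_sum Z K g \<W>"
proof -
  have "inf_cover_sum Z' K' g' \<W>' / exp c \<le> inf_cover_sum Z K g \<W>"
  proof (rule dense_ge)
    fix A assume "inf_cover_sum Z K g \<W> < A"
    then obtain \<V> h where V: "\<V> \<in> covers Z K" "finer \<V> \<W>" "\<And>V. V \<in> \<V> \<Longrightarrow> 0 \<le> h V"
      "\<And>V x. V \<in> \<V> \<Longrightarrow> x \<in> V \<Longrightarrow> exp (g x) \<le> h V" "(\<Sum>V\<in>\<V>. h V) < A"
      using inf_cover_sum_lessE[OF _ ne bdd] by metis
    have top: "topspace (subtopology Z' K') = K'" using K' by auto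
    have \<phi>K: "\<phi> x \<in> K" if "x \<in> K'" for x
      using \<phi> that unfolding continuous_map_def top by auto
    have "inf_cover_sum Z' K' g' \<W>' \<le> (\<Sum>V\<in>\<V>. exp c * h V)"
    proof (rule inf_cover_sum_le[where S = "\<lambda>V. \<phi> -` V \<inter> K'"])
      fix V assume VV: "V \<in> \<V>"
      show "\<phi> -` V \<inter> K' \<in> borel_sets_of (subtopology Z' K')"
        using borel_sets_of_vimage[OF \<phi> coversD(2)[OF V(1) VV]] top by simp
      obtain W where "W \<in> \<W>" "V \<subseteq> W" using V(2) VV by (auto simp: finer_def)
      then show "\<exists>W'\<in>\<W>'. \<phi> -` V \<inter> K' \<subseteq> W'" using fine[of W] by blast
      show "0 \<le> exp c * h V" using V(3) VV by simp
      fix x assume x: "x \<in> \<phi> -` V \<inter> K'"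
      have "exp (g' x) \<le> exp c * exp (g (\<phi> x))" using g x by (simp flip: exp_add)
      also have "\<dots> \<le> exp c * h V" using V(4) VV x by simp
      finally show "exp (g' x) \<le> exp c * h V" .
    next
      show "(\<Union>V\<in>\<V>. \<phi> -` V \<inter> K') = K'" using coversD(3)[OF V(1)] \<phi>K by auto
    qed (rule coversD(1)[OF V(1)])
    also have "\<dots> = exp c * (\<Sum>V\<in>\<V>. h V)" by (simp add: sum_distrib_left)
    also have "\<dots> \<le> exp c * A" using V(5) by simp
    finally show "inf_cover_sum Z' K' g' \<W>' / exp c \<le> A" by (simp add: field_simps)
  qed
  then show ?thesis by (simp add: field_simps)
qed

text \<open>Pull back near-optimal covers along both maps, intersect their members pairwise and
  multiply the weights; the double sum then factors.\<close>

lemma inf_cover_sum_join_le: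
  assumes K: "K \<subseteq> topspace Z" "K \<noteq> {}"
    and \<phi>1: "continuous_map (subtopology Z K) (subtopology Z1 K1) \<phi>1"
    and \<phi>2: "continuous_map (subtopology Z K) (subtopology Z2 K2) \<phi>2"
    and fine: "\<And>W1 W2. W1 \<in> \<W>1 \<Longrightarrow> W2 \<in> \<W>2 \<Longrightarrow> \<exists>W\<in>\<W>. K \<inter> \<phi>1 -` W1 \<inter> \<phi>2 -` W2 \<subseteq> W"
    and g: "\<And>x. x \<in> K \<Longrightarrow> g x \<le> g1 (\<phi>1 x) + g2 (\<phi>2 x)"
    and ne1: "\<exists>\<V>\<in>covers Z1 K1. finer \<V> \<W>1" and bdd1: "bdd_above (g1 ` K1)"
    and ne2: "\<exists>\<V>\<in>covers Z2 K2. finer \<V> \<W>2" and bdd2: "bdd_above (g2 ` K2)"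
  shows "inf_cover_sum Z K g \<W> \<le> inf_cover_sum Z1 K1 g1 \<W>1 * inf_cover_sum Z2 K2 g2 \<W>2"
    (is "?Q \<le> ?Q1 * ?Q2")
proof -
  have top: "topspace (subtopology Z K) = K" using K by auto
  have \<phi>K: "\<phi>1 x \<in> K1" "\<phi>2 x \<in> K2" if "x \<in> K" for x
    using \<phi>1 \<phi>2 that unfolding continuous_map_def top by auto
  have pos1: "0 < ?Q1"
    using K(2) \<phi>K inf_cover_sum_pos[OF _ ne1 bdd1] by blast
  have pos2: "0 < ?Q2"
    using K(2) \<phi>K inf_cover_sum_pos[OF _ ne2 bdd2] by blast
  have *: "?Q \<le> A * B" if A: "?Q1 < A" and B: "?Q2 < B" for A B
  proof -
    obtain \<V>1 h1 where V1: "\<V>1 \<in> covers Z1 K1" "finer \<V>1 \<W>1" "\<And>V. V \<in> \<V>1 \<Longrightarrow> 0 \<le> h1 V"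
      "\<And>V x. V \<in> \<V>1 \<Longrightarrow> x \<in> V \<Longrightarrow> exp (g1 x) \<le> h1 V" "(\<Sum>V\<in>\<V>1. h1 V) < A"
      by (rule inf_cover_sum_lessE[OF A ne1 bdd1]) blast
    obtain \<V>2 h2 where V2: "\<V>2 \<in> covers Z2 K2" "finer \<V>2 \<W>2" "\<And>V. V \<in> \<V>2 \<Longrightarrow> 0 \<le> h2 V"
      "\<And>V x. V \<in> \<V>2 \<Longrightarrow> x \<in> V \<Longrightarrow> exp (g2 x) \<le> h2 V" "(\<Sum>V\<in>\<V>2. h2 V) < B"
      by (rule inf_cover_sum_lessE[OF B ne2 bdd2]) blast
    have "?Q \<le> (\<Sum>p\<in>\<V>1 \<times> \<V>2. h1 (fst p) * h2 (snd p))"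
    proof (rule inf_cover_sum_le[where S = "\<lambda>p. (\<phi>1 -` fst p \<inter> K) \<inter> (\<phi>2 -` snd p \<inter> K)"])
      fix p assume "p \<in> \<V>1 \<times> \<V>2"
      then have p: "fst p \<in> \<V>1" "snd p \<in> \<V>2" by auto
      show "(\<phi>1 -` fst p \<inter> K) \<inter> (\<phi>2 -` snd p \<inter> K) \<in> borel_sets_of (subtopology Z K)"
        using borel_sets_of_vimage[OF \<phi>1 coversD(2)[OF V1(1) p(1)]]
          borel_sets_of_vimage[OF \<phi>2 coversD(2)[OF V2(1) p(2)]]
        unfolding top by (rule borel_sets_of_Int)
      obtain W1 where W1: "W1 \<in> \<W>1" "fst p \<subseteq> W1"
        using V1(2) p(1) unfolding finer_def by blast
      obtain W2 where W2: "W2 \<in> \<W>2" "snd p \<subseteq> W2"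
        using V2(2) p(2) unfolding finer_def by blast
      obtain U where U: "U \<in> \<W>" "K \<inter> \<phi>1 -` W1 \<inter> \<phi>2 -` W2 \<subseteq> U"
        using fine[OF W1(1) W2(1)] by blast
      have "(\<phi>1 -` fst p \<inter> K) \<inter> (\<phi>2 -` snd p \<inter> K) \<subseteq> U"
        using W1(2) W2(2) U(2) by auto
      then show "\<exists>U\<in>\<W>. (\<phi>1 -` fst p \<inter> K) \<inter> (\<phi>2 -` snd p \<inter> K) \<subseteq> U"
        using U(1) by (rule rev_bexI[rotated])
      show "0 \<le> h1 (fst p) * h2 (snd p)"
        using V1(3)[OF p(1)] V2(3)[OF p(2)] by simp
      fix x assume x: "x \<in> (\<phi>1 -` fst p \<inter> K) \<inter> (\<phi>2 -` snd p \<inter> K)"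
      have "exp (g x) \<le> exp (g1 (\<phi>1 x)) * exp (g2 (\<phi>2 x))"
        using g x by (simp flip: exp_add)
      also have "\<dots> \<le> h1 (fst p) * h2 (snd p)"
        using x by (intro mult_mono V1(3,4) V2(3,4) p) auto
      finally show "exp (g x) \<le> h1 (fst p) * h2 (snd p)" .
    next
      have "x \<in> (\<Union>p\<in>\<V>1 \<times> \<V>2. (\<phi>1 -` fst p \<inter> K) \<inter> (\<phi>2 -` snd p \<inter> K))"
        if x: "x \<in> K" for x
      proof -
        obtain V where V: "V \<in> \<V>1" "\<phi>1 x \<in> V"
          using \<phi>K(1)[OF x] by (auto simp flip: coversD(3)[OF V1(1)])
        obtain W where W: "W \<in> \<V>2" "\<phi>2 x \<in> W"
          using \<phi>K(2)[OF x] by (auto simp flip: coversD(3)[OF V2(1)])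
        show ?thesis using x V W by (intro UN_I[of "(V, W)"]) auto
      qed
      then show "(\<Union>p\<in>\<V>1 \<times> \<V>2. (\<phi>1 -` fst p \<inter> K) \<inter> (\<phi>2 -` snd p \<inter> K)) = K"
        by (intro equalityI subsetI) (assumption | blast)+
    qed (simp add: coversD(1)[OF V1(1)] coversD(1)[OF V2(1)])
    also have "\<dots> = (\<Sum>V\<in>\<V>1. h1 V) * (\<Sum>W\<in>\<V>2. h2 W)"
      by (simp add: sum_product sum.cartesian_product case_prod_unfold)
    also have "\<dots> \<le> A * B"
      using V1(3,5) V2(3,5) pos1 A by (intro mult_mono sum_nonneg) auto
    finally show ?thesis .
  qed
  \<comment> \<open>The two infima are approached one after the other, the other factor being moved
    to the left by division.\<close>
  have "?Q / ?Q2 \<le> ?Q1"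
  proof (rule dense_ge)
    fix A assume A: "?Q1 < A"
    have "?Q / A \<le> ?Q2"
    proof (rule dense_ge)
      fix B assume "?Q2 < B"
      then show "?Q / A \<le> B" using *[OF A, of B] A pos1 by (simp add: field_simps)
    qed
    then show "?Q / ?Q2 \<le> A" using A pos1 pos2 by (simp add: field_simps)
  qed
  then show ?thesis using pos2 by (simp add: field_simps)
qed

section \<open>Penalized block potentials\<close>

text \<open>The total, not averaged, jump: for \<open>n \<ge> 2\<close> the bound
  \<open>\<delta>\<close> in \<open>pseudo_orbits\<close> says that it is at most
  \<open>(n - 1) * \<delta>\<close>.\<close>

definition orbit_defect :: "('a::metric_space \<Rightarrow> 'a) \<Rightarrow> nat \<Rightarrow> (nat \<Rightarrow> 'a) \<Rightarrow> real" where
  "orbit_defect T n x = (\<Sum>i<n - 1. dist (T (x i)) (x (Suc i)))"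

definition penalized ::
  "('a::metric_space \<Rightarrow> 'a) \<Rightarrow> real \<Rightarrow> (nat \<Rightarrow> (nat \<Rightarrow> 'a) \<Rightarrow> real) \<Rightarrow> nat \<Rightarrow> (nat \<Rightarrow> 'a) \<Rightarrow> real" where
  "penalized T \<tau> F n x = F n x - \<tau> * orbit_defect T n x"

definition orbit_segment :: "('a \<Rightarrow> 'a) \<Rightarrow> nat \<Rightarrow> 'a \<Rightarrow> nat \<Rightarrow> 'a" where
  "orbit_segment T n x = (\<lambda>i\<in>{..<n}. (T ^^ i) x)"

text \<open>For \<open>G = penalized T \<tau> F\<close> this is \<open>Q\<^sub>n\<close> of the
  overview. The sum is over the whole power because a block of an average pseudo-orbit need not
  satisfy the same average bound, whereas the full powers split as products.\<close>

definition full_sum :: "'a::metric_space set set \<Rightarrow> (nat \<Rightarrow> (nat \<Rightarrow> 'a) \<Rightarrow> real) \<Rightarrow> nat \<Rightarrow> real" where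
  "full_sum \<U> G n = inf_cover_sum (power_top n) (topspace (power_top n)) (G n) (power_cover \<U> n)"

lemma continuous_map_power_proj:
  "i < n \<Longrightarrow> continuous_map (power_top n) euclidean (\<lambda>x. x i)"
  using continuous_map_product_projection[of i "{..<n}" "\<lambda>_. euclidean"] by simp

lemma continuous_map_orbit_defect:
  assumes "continuous_on UNIV T"
  shows "continuous_map (power_top n) euclideanreal (orbit_defect T n)"
proof -
  have "continuous_map (power_top n) euclideanreal (\<lambda>x. dist (T (x i)) (x (Suc i)))"
    if "i < n - 1" for i
  proof -
    have proj: "continuous_map (power_top n) euclidean (\<lambda>x. x i)"
      "continuous_map (power_top n) euclidean (\<lambda>x. x (Suc i))"
      using that by (auto intro: continuous_map_power_proj)
    have "continuous_map (power_top n) euclidean (T \<circ> (\<lambda>x. x i))"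
      using proj assms by (intro continuous_map_compose) auto
    then show ?thesis
      using proj(2) by (auto simp: continuous_map_atin o_def intro!: tendsto_dist)
  qed
  then show ?thesis
    unfolding orbit_defect_def[abs_def] by (intro continuous_map_sum) auto
qed

text \<open>Cutting after \<open>n\<close> coordinates loses only the jump from index
  \<open>n - 1\<close> to index \<open>n\<close>, which is nonnegative.\<close>

lemma orbit_defect_superadditive:
  assumes "1 \<le> m" "1 \<le> n"
  shows "orbit_defect T n (restrict x {..<n}) + orbit_defect T m (\<lambda>i\<in>{..<m}. x (n + i))
    \<le> orbit_defect T (n + m) x"
proof -
  define d where "d i = dist (T (x i)) (x (Suc i))" for i
  have 1: "orbit_defect T n (restrict x {..<n}) = (\<Sum>i<n - 1. d i)"
    unfolding orbit_defect_def d_def by (intro sum.cong) auto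
  have "orbit_defect T m (\<lambda>i\<in>{..<m}. x (n + i)) = (\<Sum>i<m - 1. d (n + i))"
    unfolding orbit_defect_def d_def by (intro sum.cong) auto
  also have "\<dots> = (\<Sum>i\<in>{n..<n + m - 1}. d i)"
    using assms by (intro sum.reindex_bij_witness[where i = "\<lambda>i. i - n" and j = "\<lambda>i. n + i"]) auto
  finally have 2: "orbit_defect T n (restrict x {..<n}) + orbit_defect T m (\<lambda>i\<in>{..<m}. x (n + i))
      = (\<Sum>i\<in>{..<n - 1} \<union> {n..<n + m - 1}. d i)"
    unfolding 1 by (subst sum.union_disjoint) auto
  also have "\<dots> \<le> (\<Sum>i<n + m - 1. d i)"
    using assms by (intro sum_mono2) (auto simp: d_def)
  finally show ?thesis by (simp add: orbit_defect_def d_def)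
qed

lemma block_subadditive_penalized:
  assumes "block_subadditive F" "continuous_on UNIV T" "0 \<le> \<tau>"
  shows "block_subadditive (penalized T \<tau> F)"
  unfolding block_subadditive_def
proof (intro conjI allI impI ballI)
  fix n :: nat assume "1 \<le> n"
  then show "continuous_map (power_top n) euclideanreal (penalized T \<tau> F n)"
    using assms(1) continuous_map_orbit_defect[OF assms(2), of n]
    unfolding penalized_def[abs_def] block_subadditive_def
    by (intro continuous_intros) auto
next
  fix m n :: nat and x :: "nat \<Rightarrow> 'a"
  assume *: "1 \<le> m" "1 \<le> n" "x \<in> topspace (power_top (n + m))"
  then have "F (n + m) x \<le> F n (restrict x {..<n}) + F m (\<lambda>i\<in>{..<m}. x (n + i))"
    using assms(1) unfolding block_subadditive_def by blast
  moreover note mult_left_mono[OF orbit_defect_superadditive[OF *(1,2), of T x] assms(3)]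
  ultimately show "penalized T \<tau> F (n + m) x
      \<le> penalized T \<tau> F n (restrict x {..<n}) + penalized T \<tau> F m (\<lambda>i\<in>{..<m}. x (n + i))"
    by (simp add: penalized_def algebra_simps)
qed

lemma compact_space_power:
  "compact (UNIV :: 'a::metric_space set) \<Longrightarrow> compact_space (power_top n :: (nat \<Rightarrow> 'a) topology)"
  unfolding compact_space_product_topology by (simp add: compact_space_def)

lemma block_bounds:
  fixes F :: "nat \<Rightarrow> (nat \<Rightarrow> 'a::metric_space) \<Rightarrow> real"
  assumes "block_subadditive F" "compact (UNIV :: 'a set)" "1 \<le> n"
  shows "bdd_above (F n ` topspace (power_top n))"
proof -
  have "compactin euclideanreal (F n ` topspace (power_top n))"
    using assms compact_space_power[of n, where 'a='a]
    unfolding block_subadditive_def compact_space_def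
    by (intro image_compactin) auto
  then show ?thesis
    by (intro bounded_imp_bdd_above compact_imp_bounded) simp
qed

section \<open>Orbit segments and the zeros of the defect\<close>

lemma orbit_segment_in: "orbit_segment T n x \<in> topspace (power_top n)"
  by (simp add: orbit_segment_def)

lemma continuous_on_funpow:
  fixes T :: "'a::topological_space \<Rightarrow> 'a"
  assumes "continuous_on UNIV T"
  shows "continuous_on UNIV (T ^^ n)"
proof (induction n)
  case (Suc n)
  have "continuous_on UNIV (T \<circ> (T ^^ n))"
    using Suc assms by (intro continuous_on_compose) (auto intro: continuous_on_subset)
  then show ?case by (simp add: o_def)
qed (simp add: id_def)

lemma continuous_map_orbit_segment:
  assumes "continuous_on UNIV T"
  shows "continuous_map euclidean (power_top n) (orbit_segment T n)"
proof -
  have "continuous_map euclidean euclidean (\<lambda>x. orbit_segment T n x i)" if "i < n" for i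
    using that continuous_on_funpow[OF assms] by (simp add: orbit_segment_def)
  then show ?thesis
    by (subst continuous_map_componentwise) (auto simp: orbit_segment_def)
qed

lemma orbit_defect_segment: "orbit_defect T n (orbit_segment T n x) = 0"
  unfolding orbit_defect_def orbit_segment_def by (intro sum.neutral) auto

lemma orbit_defect_nonneg: "0 \<le> orbit_defect T n x"
  unfolding orbit_defect_def by (intro sum_nonneg) auto

text \<open>A vanishing sum of distances forces each jump to vanish. Membership in the topspace
  settles the indices from \<open>n\<close> on, where both sides are
  \<open>undefined\<close>.\<close>

lemma orbit_defect_eq_0D:
  assumes "orbit_defect T n x = 0" "x \<in> topspace (power_top n)"
  shows "x = orbit_segment T n (x 0)"
proof -
  have d: "T (x i) = x (Suc i)" if "i < n - 1" for i
    using assms(1) that unfolding orbit_defect_def by (subst (asm) sum_nonneg_eq_0_iff) auto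
  have orbit: "x i = (T ^^ i) (x 0)" if "i < n" for i
    using that
  proof (induction i)
    case (Suc i)
    then show ?case using d[of i] by simp
  qed simp
  show ?thesis
  proof
    fix i show "x i = orbit_segment T n (x 0) i"
    proof (cases "i < n")
      case True
      then show ?thesis using orbit[OF True] by (simp add: orbit_segment_def)
    next
      case False
      then show ?thesis using assms(2) PiE_arb by (fastforce simp: orbit_segment_def)
    qed
  qed
qed

section \<open>Itinerary covers and product covers\<close>

text \<open>This form matches \<open>power_cover\<close>: the members are exactly the preimages
  under \<open>orbit_segment T n\<close> of products of members of \<open>\<U>\<close>.\<close>

lemma dyn_join_eq:
  "dyn_join T \<U> n = {{x. \<forall>i<n. (T ^^ i) x \<in> U i} |U. \<forall>i<n. U i \<in> \<U>}"
proof (induction n)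
  case (Suc n)
  show ?case
  proof (intro equalityI subsetI)
    fix W assume "W \<in> dyn_join T \<U> (Suc n)"
    then obtain U V where U: "\<forall>i<n. U i \<in> \<U>" "V \<in> \<U>"
      and W: "W = {x. \<forall>i<n. (T ^^ i) x \<in> U i} \<inter> (T ^^ n) -` V"
      by (auto simp: join_cover_def Suc)
    have "W = {x. \<forall>i<Suc n. (T ^^ i) x \<in> (U(n := V)) i}"
      unfolding W by (auto simp: less_Suc_eq)
    then show "W \<in> {{x. \<forall>i<Suc n. (T ^^ i) x \<in> U i} |U. \<forall>i<Suc n. U i \<in> \<U>}"
      using U unfolding mem_Collect_eq by (intro exI[of _ "U(n := V)"]) (simp add: less_Suc_eq)
  next
    fix W assume "W \<in> {{x. \<forall>i<Suc n. (T ^^ i) x \<in> U i} |U. \<forall>i<Suc n. U i \<in> \<U>}"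
    then obtain U where U: "\<forall>i<Suc n. U i \<in> \<U>" and W: "W = {x. \<forall>i<Suc n. (T ^^ i) x \<in> U i}"
      by auto
    have "W = {x. \<forall>i<n. (T ^^ i) x \<in> U i} \<inter> (T ^^ n) -` U n"
      unfolding W by (auto simp: less_Suc_eq)
    moreover have "{x. \<forall>i<n. (T ^^ i) x \<in> U i} \<in> dyn_join T \<U> n" using U Suc by auto
    ultimately show "W \<in> dyn_join T \<U> (Suc n)"
      using U by (auto simp: join_cover_def)
  qed
qed auto

text \<open>The functions \<open>U\<close> describing the products are arbitrary from index
  \<open>n\<close> on; restricting them leaves a finite set of choices.\<close>

lemma finite_power_cover: "finite \<U> \<Longrightarrow> finite (power_cover \<U> n)"
proof -
  assume "finite \<U>"
  then have "finite (Pi\<^sub>E {..<n} ` Pi\<^sub>E {..<n} (\<lambda>_. \<U>))" by (auto intro!: finite_PiE)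
  moreover have "power_cover \<U> n \<subseteq> Pi\<^sub>E {..<n} ` Pi\<^sub>E {..<n} (\<lambda>_. \<U>)"
  proof
    fix W assume "W \<in> power_cover \<U> n"
    then obtain U where W: "W = Pi\<^sub>E {..<n} U" and U: "\<forall>i<n. U i \<in> \<U>"
      unfolding power_cover_def by blast
    show "W \<in> Pi\<^sub>E {..<n} ` Pi\<^sub>E {..<n} (\<lambda>_. \<U>)"
    proof
      show "W = Pi\<^sub>E {..<n} (restrict U {..<n})" unfolding W by (rule PiE_cong) simp
      show "restrict U {..<n} \<in> Pi\<^sub>E {..<n} (\<lambda>_. \<U>)" using U by simp
    qed
  qed
  ultimately show ?thesis by (rule finite_subset[rotated])
qed

lemma open_coversD:
  assumes "\<U> \<in> open_covers euclidean UNIV"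
  shows "finite \<U>" "\<And>U. U \<in> \<U> \<Longrightarrow> open U" "\<Union>\<U> = UNIV"
  using assms by (auto simp: open_covers_def covers_def)

lemma power_cover_open_cover:
  assumes "\<U> \<in> open_covers euclidean (UNIV :: 'a::metric_space set)"
  shows "\<And>W. W \<in> power_cover \<U> n \<Longrightarrow> openin (power_top n) W"
    "\<Union>(power_cover \<U> n) = topspace (power_top n)"
proof -
  show op: "openin (power_top n) W" if W: "W \<in> power_cover \<U> n" for W
  proof -
    obtain U where "W = Pi\<^sub>E {..<n} U" "\<forall>i<n. U i \<in> \<U>"
      using W unfolding power_cover_def by blast
    then show ?thesis using open_coversD(2)[OF assms] by (simp add: openin_PiE_gen)
  qed
  show "\<Union>(power_cover \<U> n) = topspace (power_top n)"
  proof (intro equalityI subsetI)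
    fix x :: "nat \<Rightarrow> 'a" assume x: "x \<in> topspace (power_top n)"
    have "\<exists>U. \<forall>i. U i \<in> \<U> \<and> x i \<in> U i"
      using open_coversD(3)[OF assms] by (intro choice) auto
    then obtain U where U: "\<forall>i. U i \<in> \<U> \<and> x i \<in> U i" ..
    then have "Pi\<^sub>E {..<n} U \<in> power_cover \<U> n" by (auto simp: power_cover_def)
    moreover have "x \<in> Pi\<^sub>E {..<n} U" using x U by (simp add: PiE_iff)
    ultimately show "x \<in> \<Union>(power_cover \<U> n)" by blast
  next
    fix x assume "x \<in> \<Union>(power_cover \<U> n)"
    then show "x \<in> topspace (power_top n)" using op[THEN openin_subset] by blast
  qed
qed

lemma finer_covers_exist:
  assumes "finite \<W>" "\<And>W. W \<in> \<W> \<Longrightarrow> openin Z W" "K \<subseteq> \<Union>\<W>"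
  shows "\<exists>\<V>\<in>covers Z K. finer \<V> \<W>"
proof
  show "(\<inter>) K ` \<W> \<in> covers Z K"
    using assms by (auto simp: covers_def intro!: borel_sets_of_openin openin_subtopology_Int2)
  show "finer ((\<inter>) K ` \<W>) \<W>" by (auto simp: finer_def)
qed

section \<open>Comparison of the pressures\<close>

lemma power_cover_refinable:
  assumes "\<U> \<in> open_covers euclidean (UNIV :: 'a::metric_space set)"
    and "K \<subseteq> topspace (power_top n)"
  shows "\<exists>\<V>\<in>covers (power_top n) K. finer \<V> (power_cover \<U> n)"
  using assms finite_power_cover[OF open_coversD(1)[OF assms(1)]] power_cover_open_cover[OF assms(1)]
  by (intro finer_covers_exist) auto

lemma dyn_join_refinable:
  assumes "\<U> \<in> open_covers euclidean (UNIV :: 'a::metric_space set)" "continuous_on UNIV T"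
  shows "\<exists>\<V>\<in>covers euclidean UNIV. finer \<V> (dyn_join T \<U> n)"
proof -
  have "finite (dyn_join T \<U> n) \<and> (\<forall>W\<in>dyn_join T \<U> n. open W) \<and> \<Union>(dyn_join T \<U> n) = UNIV"
  proof (induction n)
    case (Suc n)
    let ?B = "(\<lambda>U. (T ^^ n) -` U) ` \<U>"
    have "dyn_join T \<U> (Suc n) = (\<lambda>(U, V). U \<inter> V) ` (dyn_join T \<U> n \<times> ?B)"
      by (auto simp: join_cover_def)
    moreover have "open ((T ^^ n) -` U)" if "U \<in> \<U>" for U
      using continuous_on_funpow[OF assms(2)] open_coversD(2)[OF assms(1) that]
      by (rule open_vimage[rotated])
    moreover have "\<Union>?B = UNIV" using open_coversD(3)[OF assms(1)] by auto
    ultimately show ?case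
      using Suc open_coversD(1)[OF assms(1)] by fastforce
  qed auto
  then show ?thesis by (intro finer_covers_exist) auto
qed

section \<open>Submultiplicativity and linear bounds\<close>

lemma full_sum_pos:
  fixes G :: "nat \<Rightarrow> (nat \<Rightarrow> 'a::metric_space) \<Rightarrow> real"
  assumes "block_subadditive G" "compact (UNIV :: 'a set)" "\<U> \<in> open_covers euclidean UNIV" "1 \<le> n"
  shows "0 < full_sum \<U> G n"
  unfolding full_sum_def
  using orbit_segment_in power_cover_refinable[OF assms(3) order_refl] block_bounds[OF assms(1,2,4)]
  by (rule inf_cover_sum_pos)

text \<open>Split a point of the power into its first \<open>n\<close> and its last \<open>m\<close>
  coordinates and join the covers of the two factors; block sub-additivity bounds the
  potential.\<close>

lemma full_sum_submultiplicative:
  fixes G :: "nat \<Rightarrow> (nat \<Rightarrow> 'a::metric_space) \<Rightarrow> real"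
  assumes G: "block_subadditive G" and "compact (UNIV :: 'a set)"
    and U: "\<U> \<in> open_covers euclidean UNIV" and n: "1 \<le> n" and m: "1 \<le> m"
  shows "full_sum \<U> G (n + m) \<le> full_sum \<U> G n * full_sum \<U> G m"
  unfolding full_sum_def
proof (rule inf_cover_sum_join_le)
  let ?Z = "power_top (n + m) :: (nat \<Rightarrow> 'a) topology"
  let ?\<phi>1 = "\<lambda>x::nat \<Rightarrow> 'a. restrict x {..<n}" and ?\<phi>2 = "\<lambda>x::nat \<Rightarrow> 'a. \<lambda>i\<in>{..<m}. x (n + i)"
  show "topspace ?Z \<noteq> {}" using orbit_segment_in by blast
  have "continuous_map ?Z (power_top n) ?\<phi>1"
    by (subst continuous_map_componentwise) (auto intro: continuous_map_power_proj)
  then show "continuous_map (subtopology ?Z (topspace ?Z))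
      (subtopology (power_top n) (topspace (power_top n))) ?\<phi>1"
    unfolding subtopology_topspace .
  have "continuous_map ?Z (power_top m) ?\<phi>2"
    by (subst continuous_map_componentwise) (auto intro: continuous_map_power_proj)
  then show "continuous_map (subtopology ?Z (topspace ?Z))
      (subtopology (power_top m) (topspace (power_top m))) ?\<phi>2"
    unfolding subtopology_topspace .
  fix W1 W2 assume "W1 \<in> power_cover \<U> n" "W2 \<in> power_cover \<U> m"
  then obtain U1 U2 where W: "W1 = Pi\<^sub>E {..<n} U1" "W2 = Pi\<^sub>E {..<m} U2"
    and UU: "\<forall>i<n. U1 i \<in> \<U>" "\<forall>i<m. U2 i \<in> \<U>"
    unfolding power_cover_def by blast
  \<comment> \<open>Concatenation of the two choices, the second shifted by
    \<open>n\<close>.\<close>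
  define V where "V i = (if i < n then U1 i else U2 (i - n))" for i
  have "Pi\<^sub>E {..<n + m} V \<in> power_cover \<U> (n + m)"
    using UU by (auto simp: power_cover_def V_def intro!: exI[of _ V])
  moreover have "topspace ?Z \<inter> ?\<phi>1 -` W1 \<inter> ?\<phi>2 -` W2 \<subseteq> Pi\<^sub>E {..<n + m} V"
  proof
    fix x assume x: "x \<in> topspace ?Z \<inter> ?\<phi>1 -` W1 \<inter> ?\<phi>2 -` W2"
    have "x i \<in> V i" if "i < n + m" for i
    proof (cases "i < n")
      case True
      then show ?thesis using x by (simp add: W V_def PiE_iff)
    next
      case False
      then have i: "i - n < m" using that by simp
      have "?\<phi>2 x \<in> Pi\<^sub>E {..<m} U2" using x W by simp
      then have "?\<phi>2 x (i - n) \<in> U2 (i - n)" by (rule PiE_mem) (simp add: i)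
      then show ?thesis using False i by (simp add: V_def)
    qed
    then show "x \<in> Pi\<^sub>E {..<n + m} V" using x by (simp add: PiE_iff)
  qed
  ultimately show "\<exists>W\<in>power_cover \<U> (n + m). topspace ?Z \<inter> ?\<phi>1 -` W1 \<inter> ?\<phi>2 -` W2 \<subseteq> W"
    by (rule bexI[rotated])
next
  fix x :: "nat \<Rightarrow> 'a" assume "x \<in> topspace (power_top (n + m))"
  then show "G (n + m) x \<le> G n (restrict x {..<n}) + G m (\<lambda>i\<in>{..<m}. x (n + i))"
    using G n m unfolding block_subadditive_def by blast
qed (use assms in \<open>simp_all only: order_refl power_cover_refinable block_bounds\<close>)

text \<open>Fekete's argument in quantitative form: write \<open>n\<close> as a multiple of
  \<open>m\<close> plus a remainder, with an error \<open>C\<close> independent of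
  \<open>n\<close>.\<close>

lemma subadditive_linear_bound:
  fixes a :: "nat \<Rightarrow> real"
  assumes sub: "\<And>n m. 1 \<le> n \<Longrightarrow> 1 \<le> m \<Longrightarrow> a (n + m) \<le> a n + a m" and m: "1 \<le> m"
  obtains C where "\<And>n. 1 \<le> n \<Longrightarrow> a n \<le> real n * (a m / real m) + C"
proof -
  have mult: "a (q * m + r) \<le> real q * a m + a r" if "1 \<le> r" for q r
  proof (induction q)
    case (Suc q)
    have "a (Suc q * m + r) = a (m + (q * m + r))" by (simp add: algebra_simps)
    also have "\<dots> \<le> a m + a (q * m + r)" using m that by (intro sub) auto
    finally show ?case using Suc by (simp add: algebra_simps)
  qed simp
  have "a n \<le> real n * (a m / real m) + (\<bar>a m\<bar> + (\<Sum>r=1..m. \<bar>a r\<bar>))" if n: "1 \<le> n" for n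
  proof -
    \<comment> \<open>Dividing \<open>n - 1\<close> instead of \<open>n\<close> keeps the remainder
      between 1 and \<open>m\<close>, so that \<open>a 0\<close>, about which nothing is assumed,
      never occurs.\<close>
    define q r where "q = (n - 1) div m" and "r = (n - 1) mod m + 1"
    have nqr: "n = q * m + r"
      using n div_mult_mod_eq[of "n - 1" m] unfolding q_def r_def by linarith
    have r: "1 \<le> r" "r \<le> m" using m by (auto simp: r_def Suc_le_eq)
    have "\<bar>a r\<bar> \<le> (\<Sum>r=1..m. \<bar>a r\<bar>)" using r by (intro member_le_sum) auto
    then have "a n \<le> real q * a m + (\<Sum>r=1..m. \<bar>a r\<bar>)"
      using mult[OF r(1), of q] nqr by simp
    \<comment> \<open>Replacing \<open>q\<close> by \<open>n / m\<close> costs at most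
      \<open>\<bar>a m\<bar>\<close>, because \<open>r \<le> m\<close>.\<close>
    moreover have "real q * a m = real n * (a m / real m) - real r / real m * a m"
      using m by (simp add: nqr field_simps)
    moreover have "\<bar>real r / real m * a m\<bar> \<le> 1 * \<bar>a m\<bar>"
      unfolding abs_mult using r m by (intro mult_right_mono) auto
    ultimately show ?thesis by linarith
  qed
  then show thesis by (rule that)
qed

section \<open>Large penalties concentrate cover sums near orbits\<close>

text \<open>The full power is covered by open sets around the orbit segments, weighted almost as in
  a near-optimal cover for \<open>P_n\<close>, and by a compact remainder on which a large penalty
  makes the weights negligible.\<close>

lemma full_sum_penalized_le:
  fixes T :: "'a::metric_space \<Rightarrow> 'a"
  assumes T: "tds T" and F: "block_subadditive F" and U: "\<U> \<in> open_covers euclidean UNIV"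
    and m: "1 \<le> m" and A: "P_n T (induced_potential T F) \<U> m < A"
  obtains \<tau> where "0 \<le> \<tau>" "full_sum \<U> (penalized T \<tau> F) m \<le> A"
proof -
  have comp: "compact (UNIV :: 'a set)" and cont: "continuous_on UNIV T"
    using T by (auto simp: tds_def)
  let ?Z = "power_top m :: (nat \<Rightarrow> 'a) topology"
  obtain M where M: "\<And>y. y \<in> topspace ?Z \<Longrightarrow> F m y \<le> M"
    using block_bounds[OF F comp m] unfolding bdd_above_def by blast
  have bdd: "bdd_above (induced_potential T F m ` UNIV)"
    using M[OF orbit_segment_in] by (auto intro!: bdd_aboveI simp: induced_potential_def orbit_segment_def)
  obtain \<V> h where V: "\<V> \<in> covers euclidean UNIV" "finer \<V> (dyn_join T \<U> m)"
    and h0: "\<And>V. V \<in> \<V> \<Longrightarrow> 0 \<le> h V"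
    and h: "\<And>V x. V \<in> \<V> \<Longrightarrow> x \<in> V \<Longrightarrow> exp (induced_potential T F m x) \<le> h V"
    and hA: "(\<Sum>V\<in>\<V>. h V) < A"
    using A unfolding P_n_def
    by (rule inf_cover_sum_lessE[OF _ dyn_join_refinable[OF U cont] bdd]) blast
  \<comment> \<open>Half of the slack pays for enlarging the weights near orbits, by
    \<open>e\<close> for each member of \<open>\<V>\<close>; the other half pays for the remainder,
    by \<open>b\<close> for each product set. The \<open>+ 1\<close> in both denominators avoids a
    division by zero.\<close>
  define \<epsilon> where "\<epsilon> = (A - (\<Sum>V\<in>\<V>. h V)) / 2"
  have \<epsilon>: "0 < \<epsilon>" using hA by (simp add: \<epsilon>_def)
  define e where "e = \<epsilon> / (card \<V> + 1)"
  have e: "0 < e" "card \<V> * e \<le> \<epsilon>" using \<epsilon> by (auto simp: e_def field_simps)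
  define b where "b = \<epsilon> / (card (power_cover \<U> m) + 1)"
  have b: "0 < b" "card (power_cover \<U> m) * b \<le> \<epsilon>" using \<epsilon> by (auto simp: b_def field_simps)
  have "\<exists>W\<in>power_cover \<U> m. \<forall>x\<in>V. orbit_segment T m x \<in> W" if "V \<in> \<V>" for V
  proof -
    obtain W where "W \<in> dyn_join T \<U> m" "V \<subseteq> W" using V(2) \<open>V \<in> \<V>\<close> unfolding finer_def by blast
    then obtain U where U: "\<forall>i<m. U i \<in> \<U>" "V \<subseteq> {x. \<forall>i<m. (T ^^ i) x \<in> U i}"
      unfolding dyn_join_eq by blast
    have "Pi\<^sub>E {..<m} U \<in> power_cover \<U> m" using U(1) by (auto simp: power_cover_def)
    moreover have "\<forall>x\<in>V. orbit_segment T m x \<in> Pi\<^sub>E {..<m} U"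
      using U(2) by (auto simp: orbit_segment_def)
    ultimately show ?thesis by blast
  qed
  then obtain w where w: "\<And>V. V \<in> \<V> \<Longrightarrow> w V \<in> power_cover \<U> m"
    "\<And>V x. V \<in> \<V> \<Longrightarrow> x \<in> V \<Longrightarrow> orbit_segment T m x \<in> w V" by metis
  \<comment> \<open>An open enlargement of the orbit segments starting in \<open>V\<close>: the
    margin \<open>e\<close> makes the bound on \<open>exp (F m y)\<close> strict there, and staying
    inside \<open>w V\<close> keeps the cover finer than \<open>power_cover \<U> m\<close>.\<close>
  define S where "S V = w V \<inter> {y \<in> topspace ?Z. exp (F m y) \<in> {..<h V + e}}" for V
  have "continuous_map ?Z euclideanreal (F m)" using F m by (auto simp: block_subadditive_def)
  then have "continuous_map ?Z euclideanreal (exp \<circ> F m)"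
    by (rule continuous_map_compose) (auto intro!: continuous_intros)
  then have "openin ?Z {y \<in> topspace ?Z. exp (F m y) \<in> {..<c}}" for c
    using openin_continuous_map_preimage[of ?Z euclideanreal "exp \<circ> F m" "{..<c}"] by simp
  then have S_open: "openin ?Z (S V)" if "V \<in> \<V>" for V
    using power_cover_open_cover(1)[OF U w(1)[OF that]] unfolding S_def by (rule openin_Int[rotated])
  define R where "R = topspace ?Z - (\<Union>V\<in>\<V>. S V)"
  have R_closed: "closedin ?Z R"
    unfolding R_def by (rule closedin_diff[OF closedin_topspace openin_Union]) (use S_open in blast)
  have orbit_S: "orbit_segment T m x \<in> (\<Union>V\<in>\<V>. S V)" for x
  proof -
    obtain V where V: "V \<in> \<V>" "x \<in> V" using coversD(3)[OF V(1)] by blast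
    have "exp (F m (orbit_segment T m x)) < h V + e"
      using h[OF V] e(1) by (simp add: induced_potential_def orbit_segment_def)
    then have "orbit_segment T m x \<in> S V"
      unfolding S_def using w(2)[OF V] orbit_segment_in by blast
    then show ?thesis using V(1) by blast
  qed
  have R_pos: "0 < orbit_defect T m y" if "y \<in> R" for y
  proof (rule ccontr)
    assume "\<not> 0 < orbit_defect T m y"
    then have "orbit_defect T m y = 0" using orbit_defect_nonneg[of T m y] by linarith
    moreover have "y \<in> topspace ?Z" using that by (simp add: R_def)
    ultimately have "y \<in> (\<Union>V\<in>\<V>. S V)" using orbit_defect_eq_0D orbit_S by metis
    then show False using that unfolding R_def by blast
  qed
  \<comment> \<open>The defect is continuous and positive on the compact set \<open>R\<close>, so it
    attains a positive minimum; if \<open>R\<close> is empty, any positive number will do.\<close>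
  obtain \<eta> where \<eta>: "0 < \<eta>" "\<And>y. y \<in> R \<Longrightarrow> \<eta> \<le> orbit_defect T m y"
  proof (cases "R = {}")
    case True
    then show thesis using that[of 1] by simp
  next
    case False
    have "compactin ?Z R"
      using closedin_compact_space[OF compact_space_power[OF comp] R_closed] .
    then have "compact (orbit_defect T m ` R)"
      using image_compactin[OF _ continuous_map_orbit_defect[OF cont]] by fastforce
    then obtain y where "y \<in> R" "\<forall>z\<in>R. orbit_defect T m y \<le> orbit_defect T m z"
      using compact_attains_inf[of "orbit_defect T m ` R"] False by auto
    then show thesis using that[of "orbit_defect T m y"] R_pos by blast
  qed
  \<comment> \<open>Chosen so that \<open>exp (M - \<tau> * \<eta>) \<le> b\<close>, which bounds
    the penalized weights on \<open>R\<close>.\<close>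
  define \<tau> where "\<tau> = max 0 ((M - ln b) / \<eta>)"
  have \<tau>: "0 \<le> \<tau>" "M - \<tau> * \<eta> \<le> ln b"
  proof -
    have "(M - ln b) / \<eta> \<le> \<tau>" by (simp add: \<tau>_def)
    then show "M - \<tau> * \<eta> \<le> ln b" using \<eta>(1) by (simp add: field_simps)
  qed (simp add: \<tau>_def)
  have finV: "finite \<V>" by (rule coversD(1)[OF V(1)])
  have finP: "finite (power_cover \<U> m)" by (rule finite_power_cover[OF open_coversD(1)[OF U]])
  \<comment> \<open>The left indices carry the sets near orbits; the right ones cut \<open>R\<close>
    along the product sets, as refinement requires.\<close>
  let ?S = "case_sum S (\<lambda>W. W \<inter> R)" and ?h = "case_sum (\<lambda>V. h V + e) (\<lambda>_. b)"
  have "full_sum \<U> (penalized T \<tau> F) m \<le> (\<Sum>i\<in>\<V> <+> power_cover \<U> m. ?h i)"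
    unfolding full_sum_def
  proof (rule inf_cover_sum_le[where S = ?S])
    show "finite (\<V> <+> power_cover \<U> m)" using finV finP by simp
    show "(\<Union>i\<in>\<V> <+> power_cover \<U> m. ?S i) = topspace ?Z"
    proof -
      have "(\<Union>i\<in>\<V> <+> power_cover \<U> m. ?S i) = (\<Union>V\<in>\<V>. S V) \<union> (\<Union>(power_cover \<U> m) \<inter> R)"
        by (auto simp: Plus_def)
      also have "\<dots> = (\<Union>V\<in>\<V>. S V) \<union> R"
        unfolding power_cover_open_cover(2)[OF U] R_def by blast
      also have "\<dots> = topspace ?Z"
        using S_open[THEN openin_subset] unfolding R_def by blast
      finally show ?thesis .
    qed
    fix i assume i: "i \<in> \<V> <+> power_cover \<U> m"
    then consider V where "i = Inl V" "V \<in> \<V>" | W where "i = Inr W" "W \<in> power_cover \<U> m"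
      by blast
    then have "?S i \<in> borel_sets_of ?Z \<and> (\<exists>W\<in>power_cover \<U> m. ?S i \<subseteq> W) \<and> 0 \<le> ?h i \<and>
        (\<forall>y\<in>?S i. exp (penalized T \<tau> F m y) \<le> ?h i)"
    proof cases
      case 1
      have "exp (penalized T \<tau> F m y) \<le> h V + e" if "y \<in> S V" for y
      proof -
        have "exp (penalized T \<tau> F m y) \<le> exp (F m y)"
          using \<tau>(1) orbit_defect_nonneg[of T m y] by (simp add: penalized_def)
        also have "\<dots> \<le> h V + e" using that by (simp add: S_def)
        finally show ?thesis .
      qed
      moreover have "S V \<subseteq> w V" by (auto simp: S_def)
      ultimately show ?thesis
        using 1 borel_sets_of_openin[OF S_open[OF 1(2)]] h0[OF 1(2)] e(1) w(1)[OF 1(2)] by auto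
    next
      case 2
      have "R = topspace ?Z - (topspace ?Z - R)" by (auto simp: R_def)
      then have "R \<in> borel_sets_of ?Z"
        using R_closed by (metis borel_sets_of_Diff borel_sets_of_openin closedin_def openin_topspace)
      then have "W \<inter> R \<in> borel_sets_of ?Z"
        using borel_sets_of_openin power_cover_open_cover(1)[OF U 2(2)] by (intro borel_sets_of_Int)
      moreover have "exp (penalized T \<tau> F m y) \<le> b" if "y \<in> R" for y
      proof -
        have "\<tau> * \<eta> \<le> \<tau> * orbit_defect T m y" using \<eta>(2)[OF that] \<tau>(1) by (rule mult_left_mono)
        moreover have "F m y \<le> M" using that by (intro M) (simp add: R_def)
        ultimately have "penalized T \<tau> F m y \<le> ln b" using \<tau>(2) by (simp add: penalized_def)
        then show ?thesis using b(1) by (simp add: ln_ge_iff)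
      qed
      ultimately show ?thesis using 2 b(1) by auto
    qed
    then show "?S i \<in> borel_sets_of (subtopology ?Z (topspace ?Z))"
      "\<exists>W\<in>power_cover \<U> m. ?S i \<subseteq> W" "0 \<le> ?h i"
      "\<And>y. y \<in> ?S i \<Longrightarrow> exp (penalized T \<tau> F m y) \<le> ?h i"
      unfolding subtopology_topspace by blast+
  qed
  also have "\<dots> = (\<Sum>V\<in>\<V>. h V) + card \<V> * e + card (power_cover \<U> m) * b"
    using finV finP by (simp add: sum.Plus o_def sum.distrib)
  also have "\<dots> \<le> A" using e(2) b(2) by (simp add: \<epsilon>_def)
  finally show thesis using that \<tau>(1) by blast
qed

section \<open>Inequalities between the pressures\<close>

text \<open>On pseudo-orbits the defect is at most \<open>(n - 1) * \<delta>\<close>, so removing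
  the penalty raises the potential by at most \<open>n * \<tau> * \<delta>\<close>. Covers of the
  full power are then restricted to the pseudo-orbits.\<close>

lemma GP_n_delta_le_full_sum:
  fixes T :: "'a::metric_space \<Rightarrow> 'a"
  assumes T: "tds T" and F: "block_subadditive F" and U: "\<U> \<in> open_covers euclidean UNIV"
    and "2 \<le> n" "0 \<le> \<tau>" "0 \<le> \<delta>"
  shows "GP_n_delta T F \<U> \<delta> n \<le> exp (real n * (\<tau> * \<delta>)) * full_sum \<U> (penalized T \<tau> F) n"
  unfolding GP_n_delta_def full_sum_def
proof (rule inf_cover_sum_comp_le[where \<phi> = "\<lambda>x. x"])
  have comp: "compact (UNIV :: 'a set)" and cont: "continuous_on UNIV T"
    using T by (auto simp: tds_def)
  show "pseudo_orbits T \<delta> n \<subseteq> topspace (power_top n)" by (auto simp: pseudo_orbits_def)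
  show "continuous_map (subtopology (power_top n) (pseudo_orbits T \<delta> n))
      (subtopology (power_top n) (topspace (power_top n))) (\<lambda>x. x)"
    unfolding subtopology_topspace by (rule continuous_map_from_subtopology) simp
  show "\<exists>\<V>\<in>covers (power_top n) (topspace (power_top n)). finer \<V> (power_cover \<U> n)"
    by (rule power_cover_refinable[OF U order_refl])
  show "bdd_above (penalized T \<tau> F n ` topspace (power_top n))"
    using assms by (intro block_bounds block_subadditive_penalized comp cont) auto
  fix x assume "x \<in> pseudo_orbits T \<delta> n"
  then have "orbit_defect T n x \<le> \<delta> * real (n - 1)"
    using assms by (simp add: pseudo_orbits_def orbit_defect_def field_simps)
  also have "\<dots> \<le> \<delta> * real n" using assms by (intro mult_left_mono) auto
  finally have "\<tau> * orbit_defect T n x \<le> \<tau> * (\<delta> * real n)" using assms by (intro mult_left_mono)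
  then show "F n x \<le> real n * (\<tau> * \<delta>) + penalized T \<tau> F n x"
    by (simp add: penalized_def algebra_simps)
qed auto

lemma P_n_pos:
  fixes T :: "'a::metric_space \<Rightarrow> 'a"
  assumes T: "tds T" and F: "block_subadditive F" and U: "\<U> \<in> open_covers euclidean UNIV" and "1 \<le> n"
  shows "0 < P_n T (induced_potential T F) \<U> n"
  unfolding P_n_def
proof (rule inf_cover_sum_pos[OF UNIV_I dyn_join_refinable[OF U]])
  have comp: "compact (UNIV :: 'a set)" using T by (auto simp: tds_def)
  show "continuous_on UNIV T" using T by (auto simp: tds_def)
  have "induced_potential T F n ` UNIV = F n ` orbit_segment T n ` UNIV"
    by (auto simp: induced_potential_def orbit_segment_def)
  also have "\<dots> \<subseteq> F n ` topspace (power_top n)" using orbit_segment_in by blast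
  finally show "bdd_above (induced_potential T F n ` UNIV)"
    using block_bounds[OF F comp assms(4)] by (rule bdd_above_mono[rotated])
qed

text \<open>Orbit segments have no jumps and so are pseudo-orbits for every
  \<open>\<delta> \<ge> 0\<close>; covers of the pseudo-orbits pull back to covers of the space, and
  \<open>F n\<close> pulls back to the induced potential.\<close>

lemma P_n_le_GP_n_delta:
  fixes T :: "'a::metric_space \<Rightarrow> 'a"
  assumes T: "tds T" and F: "block_subadditive F" and U: "\<U> \<in> open_covers euclidean UNIV"
    and "1 \<le> n" "0 \<le> \<delta>"
  shows "P_n T (induced_potential T F) \<U> n \<le> GP_n_delta T F \<U> \<delta> n"
proof -
  have comp: "compact (UNIV :: 'a set)" and cont: "continuous_on UNIV T"
    using T by (auto simp: tds_def)
  have pseudo: "orbit_segment T n x \<in> pseudo_orbits T \<delta> n" for x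
    using orbit_defect_segment[of T n x] orbit_segment_in[of T n x] assms(5)
    unfolding pseudo_orbits_def orbit_defect_def by simp
  have sub: "pseudo_orbits T \<delta> n \<subseteq> topspace (power_top n)" by (auto simp: pseudo_orbits_def)
  have "P_n T (induced_potential T F) \<U> n \<le> exp 0 * GP_n_delta T F \<U> \<delta> n"
    unfolding GP_n_delta_def P_n_def
  proof (rule inf_cover_sum_comp_le[where \<phi> = "orbit_segment T n"])
    show "continuous_map (subtopology euclidean UNIV)
        (subtopology (power_top n) (pseudo_orbits T \<delta> n)) (orbit_segment T n)"
      using continuous_map_orbit_segment[OF cont] pseudo
      by (auto simp: continuous_map_in_subtopology)
    show "\<exists>\<V>\<in>covers (power_top n) (pseudo_orbits T \<delta> n). finer \<V> (power_cover \<U> n)"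
      by (rule power_cover_refinable[OF U sub])
    show "bdd_above (F n ` pseudo_orbits T \<delta> n)"
      using block_bounds[OF F comp assms(4)] image_mono[OF sub] by (rule bdd_above_mono)
    fix W assume "W \<in> power_cover \<U> n"
    then obtain V where W: "W = Pi\<^sub>E {..<n} V" "\<forall>i<n. V i \<in> \<U>"
      unfolding power_cover_def by blast
    have "{x. \<forall>i<n. (T ^^ i) x \<in> V i} \<in> dyn_join T \<U> n"
      using W(2) unfolding dyn_join_eq by blast
    moreover have "UNIV \<inter> orbit_segment T n -` W \<subseteq> {x. \<forall>i<n. (T ^^ i) x \<in> V i}"
    proof (intro subsetI CollectI allI impI)
      fix x i assume "x \<in> UNIV \<inter> orbit_segment T n -` W" "i < n"
      then have "orbit_segment T n x i \<in> V i" using W(1) PiE_mem[of _ "{..<n}" V i] by simp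
      then show "(T ^^ i) x \<in> V i" using \<open>i < n\<close> by (simp add: orbit_segment_def)
    qed
    ultimately show "\<exists>W'\<in>dyn_join T \<U> n. UNIV \<inter> orbit_segment T n -` W \<subseteq> W'" by blast
  qed (auto simp: induced_potential_def orbit_segment_def)
  then show ?thesis by simp
qed

text \<open>The parameters are chosen in order: \<open>\<tau>\<close> depends on \<open>m\<close>
  and \<open>e\<close>, and then \<open>\<delta>\<close> on \<open>\<tau>\<close>. Half of
  \<open>e\<close> is spent on passing from \<open>P_n\<close> to the penalized sum at
  \<open>m\<close>, half on the cost \<open>\<tau> * \<delta>\<close>.\<close>

lemma GP_le_P_n:
  fixes T :: "'a::metric_space \<Rightarrow> 'a"
  assumes T: "tds T" and F: "block_subadditive F" and U: "\<U> \<in> open_covers euclidean UNIV"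
    and m: "1 \<le> m"
  shows "GP T F \<U> \<le> ereal (ln (P_n T (induced_potential T F) \<U> m) / real m)"
proof (rule ereal_le_epsilon2)
  have comp: "compact (UNIV :: 'a set)" and cont: "continuous_on UNIV T"
    using T by (auto simp: tds_def)
  define p where "p = P_n T (induced_potential T F) \<U> m"
  have p: "0 < p" unfolding p_def using assms by (rule P_n_pos)
  fix e :: real assume e: "0 < e"
  \<comment> \<open>The factor \<open>exp (m * e / 2)\<close> becomes an additive
    \<open>e / 2\<close> after taking the logarithm and dividing by \<open>m\<close>.\<close>
  have "p * 1 < p * exp (real m * (e / 2))" using p m e by (intro mult_strict_left_mono) auto
  then obtain \<tau> where \<tau>: "0 \<le> \<tau>"
    and Q: "full_sum \<U> (penalized T \<tau> F) m \<le> p * exp (real m * (e / 2))"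
    using full_sum_penalized_le[OF assms] unfolding p_def by (metis mult.right_neutral)
  define G where "G = penalized T \<tau> F"
  have G: "block_subadditive G" unfolding G_def by (rule block_subadditive_penalized[OF F cont \<tau>])
  define a where "a n = ln (full_sum \<U> G n)" for n
  have pos: "0 < full_sum \<U> G n" if "1 \<le> n" for n by (rule full_sum_pos[OF G comp U that])
  have "a (n + k) \<le> a n + a k" if "1 \<le> n" "1 \<le> k" for n k
    using full_sum_submultiplicative[OF G comp U that] pos[of n] pos[of k] pos[of "n + k"] that
    unfolding a_def by (subst ln_mult_pos[symmetric]) auto
  then obtain C where C: "\<And>n. 1 \<le> n \<Longrightarrow> a n \<le> real n * (a m / real m) + C"
    using subadditive_linear_bound[OF _ m] by blast
  have "a m \<le> ln (p * exp (real m * (e / 2)))"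
    unfolding a_def using Q pos[OF m] p by (subst ln_le_cancel_iff) (auto simp: G_def)
  also have "\<dots> = ln p + real m * (e / 2)" using p by (simp add: ln_mult_pos)
  finally have am: "a m / real m \<le> ln p / real m + e / 2" using m by (simp add: field_simps)
  \<comment> \<open>The \<open>+ 1\<close> covers the case \<open>\<tau> = 0\<close>.\<close>
  define \<delta> where "\<delta> = e / 2 / (\<tau> + 1)"
  have \<delta>: "0 < \<delta>" "\<tau> * \<delta> \<le> e / 2" using e \<tau> by (auto simp: \<delta>_def field_simps)
  have "ln (GP_n_delta T F \<U> \<delta> n) / real n \<le> ln p / real m + e + C / real n" if n: "2 \<le> n" for n
  proof -
    have n1: "1 \<le> n" using n by simp
    have "0 < GP_n_delta T F \<U> \<delta> n"
      using P_n_pos[OF T F U n1] P_n_le_GP_n_delta[OF T F U n1, of \<delta>] \<delta>(1) by linarith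
    moreover have "GP_n_delta T F \<U> \<delta> n \<le> exp (real n * (\<tau> * \<delta>)) * full_sum \<U> G n"
      unfolding G_def using assms n \<tau> \<delta> by (intro GP_n_delta_le_full_sum) auto
    ultimately have "ln (GP_n_delta T F \<U> \<delta> n) \<le> ln (exp (real n * (\<tau> * \<delta>)) * full_sum \<U> G n)"
      by simp
    also have "\<dots> = real n * (\<tau> * \<delta>) + a n"
      using pos[OF n1] by (simp add: ln_mult_pos a_def)
    also have "\<dots> \<le> real n * (e / 2) + (real n * (ln p / real m + e / 2) + C)"
      using C[OF n1] mult_left_mono[OF am, of "real n"] mult_left_mono[OF \<delta>(2), of "real n"] by linarith
    also have "\<dots> = real n * (ln p / real m + e + C / real n)" using n by (simp add: field_simps)
    finally show ?thesis using n by (simp add: divide_le_eq mult.commute)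
  qed
  \<comment> \<open>With \<open>m\<close>, \<open>\<tau>\<close> and \<open>\<delta>\<close> fixed,
    \<open>C\<close> does not depend on \<open>n\<close>, so \<open>C / n\<close> disappears in the
    upper limit.\<close>
  then have "GP_delta T F \<U> \<delta> \<le> limsup (\<lambda>n. ereal (ln p / real m + e + C / real n))"
    unfolding GP_delta_def
    by (intro Limsup_mono) (auto simp: eventually_sequentially intro!: exI[of _ 2])
  also have "\<dots> = ereal (ln p / real m + e)"
  proof (rule lim_imp_Limsup)
    have "(\<lambda>n. ln p / real m + e + C / real n) \<longlonglongrightarrow> ln p / real m + e + 0"
      by (intro tendsto_intros lim_const_over_n)
    then show "(\<lambda>n. ereal (ln p / real m + e + C / real n)) \<longlonglongrightarrow> ereal (ln p / real m + e)"
      by simp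
  qed simp
  finally have "GP_delta T F \<U> \<delta> \<le> ereal (ln p / real m) + ereal e" by simp
  moreover have "GP T F \<U> \<le> GP_delta T F \<U> \<delta>" unfolding GP_def using \<delta>(1) by (intro INF_lower) simp
  ultimately show "GP T F \<U> \<le> ereal (ln (P_n T (induced_potential T F) \<U> m) / real m) + ereal e"
    unfolding p_def by (rule order_trans[rotated])
qed

lemma limsup_P_n_le_GP:
  fixes T :: "'a::metric_space \<Rightarrow> 'a"
  assumes T: "tds T" and F: "block_subadditive F" and U: "\<U> \<in> open_covers euclidean UNIV"
  shows "limsup (\<lambda>n. ereal (ln (P_n T (induced_potential T F) \<U> n) / real n)) \<le> GP T F \<U>"
  unfolding GP_def
proof (rule INF_greatest)
  fix \<delta> :: real assume "\<delta> \<in> {0<..}"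
  then have "ln (P_n T (induced_potential T F) \<U> n) / real n \<le> ln (GP_n_delta T F \<U> \<delta> n) / real n"
    if "1 \<le> n" for n
    using P_n_pos[OF assms that] P_n_le_GP_n_delta[OF assms that, of \<delta>] by (intro divide_right_mono) auto
  then show "limsup (\<lambda>n. ereal (ln (P_n T (induced_potential T F) \<U> n) / real n)) \<le> GP_delta T F \<U> \<delta>"
    unfolding GP_delta_def
    by (intro Limsup_mono) (auto simp: eventually_sequentially intro!: exI[of _ 1])
qed

theorem theorem1p3:
  fixes T :: "'a::metric_space \<Rightarrow> 'a"
    and F :: "nat \<Rightarrow> (nat \<Rightarrow> 'a) \<Rightarrow> real"
    and \<U> :: "'a set set"
  assumes "tds T"
    and "block_subadditive F"
    and "\<U> \<in> open_covers euclidean UNIV"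
    and "\<forall>\<mu> \<in> invariant_measures T. potential_mean (induced_potential T F) \<mu> > -\<infinity>"
  shows "GP T F \<U> = pressure T (induced_potential T F) \<U>"
proof -
  let ?x = "\<lambda>n. ereal (ln (P_n T (induced_potential T F) \<U> n) / real n)"
  \<comment> \<open>\<open>GP\<close> lies below every term with index at least 1, hence below the
    lower limit. As it also lies above the upper limit, the sequence converges to it, which gives
    \<open>lim\<close> in \<open>pressure\<close> its value.\<close>
  have "GP T F \<U> \<le> liminf ?x"
    using GP_le_P_n[OF assms(1-3)]
    by (intro Liminf_bounded) (auto simp: eventually_sequentially intro!: exI[of _ 1])
  moreover have "limsup ?x \<le> GP T F \<U>" by (rule limsup_P_n_le_GP[OF assms(1-3)])
  ultimately have "?x \<longlonglongrightarrow> GP T F \<U>"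
    using Liminf_le_Limsup[of sequentially ?x]
    by (intro Liminf_eq_Limsup) (auto intro: antisym order_trans)
  then show ?thesis unfolding pressure_def by (rule limI[symmetric])
qed

end
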